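(* For every integer $r\ge 3$, we have $g_r=\dfrac{r!}{r^r}$ and, furthermore, the interval $\left(0,\dfrac{r!}{r^r}\right)$ is the only gap of length $\dfrac{r!}{r^r}$ for $r$-graphs. Here a gap (for $r$-graphs) is an open interval $(a,b)\subseteq(0,1)$ disjoint from the set $\Pi_\infty^{(r)}$ of all Turán densities of $r$-graph families, and $g_r$ is the maximal possible length of a gap, that is, the maximal $g$ such that there is a real $a$ with $(a,a+g)\subseteq (0,1)\setminus \Pi_\infty^{(r)}$.
   Context: Let $r\ge 2$ be an integer. An $r$-graph is an $r$-uniform set system, i.e. a finite vertex set together with a collection of $r$-element subsets of it (edges). Let $\mathcal F$ be a (possibly infinite, possibly empty) family of $r$-graphs, each having at least one edge. An $r$-graph $G$ is $\mathcal F$-free if no member $F\in\mathcal F$ is a subgraph of $G$, i.e. no $F\in\mathcal F$ can be obtained (up to isomorphism) by deleting some vertices and edges from $G$ (subgraphs are not required to be induced). The Turán function $\mathrm{ex}(n,\mathcal F)$ is the maximum number of edges in an $\mathcal F$-free $r$-graph on $n$ vertices. The Turán density of $\mathcal F$ is $\pi(\mathcal F):=\lim_{n\to\infty}\mathrm{ex}(n,\mathcal F)/\binom{n}{r}$ (the limit is known to exist). $\Pi_\infty^{(r)}\subseteq[0,1]$ denotes the set of all values $\pi(\mathcal F)$ over all such families $\mathcal F$ of $r$-graphs (finite or infinite; the empty family is allowed, so $1\in\Pi_\infty^{(r)}$). *)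

theory Defs
  imports Complex_Main
begin

type_synonym 'a hgraph = "'a set \<times> 'a set set"

abbreviation verts :: "'a hgraph \<Rightarrow> 'a set" where
  "verts G \<equiv> fst G"

abbreviation edges :: "'a hgraph \<Rightarrow> 'a set set" where
  "edges G \<equiv> snd G"

definition r_graph :: "nat \<Rightarrow> 'a hgraph \<Rightarrow> bool" where
  "r_graph r G \<longleftrightarrow> finite (verts G) \<and> (\<forall>e\<in>edges G. e \<subseteq> verts G \<and> card e = r)"

text \<open>Not necessarily induced.\<close>

definition subgraph_of :: "'a hgraph \<Rightarrow> 'a hgraph \<Rightarrow> bool" where
  "subgraph_of H G \<longleftrightarrow>
     verts H \<subseteq> verts G \<and> edges H \<subseteq> edges G \<and> (\<forall>e\<in>edges H. e \<subseteq> verts H)"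

definition hgraph_iso :: "'a hgraph \<Rightarrow> 'b hgraph \<Rightarrow> bool" where
  "hgraph_iso F H \<longleftrightarrow>
     (\<exists>f. bij_betw f (verts F) (verts H) \<and> edges H = (\<lambda>e. f ` e) ` edges F)"

definition free_of :: "'a hgraph set \<Rightarrow> 'b hgraph \<Rightarrow> bool" where
  "free_of \<F> G \<longleftrightarrow> \<not> (\<exists>F\<in>\<F>. \<exists>H. subgraph_of H G \<and> hgraph_iso F H)"

text \<open>
  Since all graphs are finite and only matter up to isomorphism, it suffices to take
  natural numbers as vertices.
  In \<open>turan_ex\<close> the maximum is over a finite set (bounded by the binomial coefficient
  \<open>n choose r\<close>), and this set is nonempty when every member of the family has an edge, because
  then the edgeless graph is admissible.
\<close>

definition turan_family :: "nat \<Rightarrow> nat hgraph set \<Rightarrow> bool" where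
  "turan_family r \<F> \<longleftrightarrow> (\<forall>F\<in>\<F>. r_graph r F \<and> edges F \<noteq> {})"

definition turan_ex :: "nat \<Rightarrow> nat \<Rightarrow> nat hgraph set \<Rightarrow> nat" where
  "turan_ex r n \<F> =
     Max {card (edges G) | G :: nat hgraph. r_graph r G \<and> card (verts G) = n \<and> free_of \<F> G}"

definition turan_density :: "nat \<Rightarrow> nat hgraph set \<Rightarrow> real" where
  "turan_density r \<F> = lim (\<lambda>n. real (turan_ex r n \<F>) / real (n choose r))"

definition turan_densities :: "nat \<Rightarrow> real set" where
  "turan_densities r = {turan_density r \<F> | \<F>. turan_family r \<F>}"

definition is_gap :: "nat \<Rightarrow> real \<Rightarrow> real \<Rightarrow> bool" where
  "is_gap r a b \<longleftrightarrow> a < b \<and> {a<..<b} \<subseteq> {0<..<1} \<and> {a<..<b} \<inter> turan_densities r = {}"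

definition gap_lengths :: "nat \<Rightarrow> real set" where
  "gap_lengths r = {g. \<exists>a. is_gap r a (a + g)}"

text \<open>
  \<open>Greatest\<close> is unspecified when no maximum exists, so a statement about \<open>max_gap r\<close> should
  also assert that the maximum is attained.
\<close>

definition max_gap :: "nat \<Rightarrow> real" where
  "max_gap r = (GREATEST g. g \<in> gap_lengths r)"

end

theory Submission
  imports Defs "HOL-Analysis.Convex" "HOL-Library.FuncSet" "HOL-Library.Nat_Bijection"
begin

text \<open>
  Put \<open>\<gamma> = r!/r^r\<close>. By Erdos' theorem a family with an \<open>r\<close>-partite member has density \<open>0\<close>, and a
  family without one has density at least \<open>\<gamma>\<close>, because all \<open>r\<close>-partite \<open>r\<close>-graphs are free of it.
  Hence \<open>(0, \<gamma>)\<close> is a gap.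

  Conversely, for a set \<open>P\<close> of \<open>r\<close>-subsets of a finite set of colours, let \<open>d(P)\<close> be the density of
  the family of all \<open>r\<close>-graphs that have no colouring mapping every edge onto a member of \<open>P\<close>. Then
  \<open>d(P) = \<gamma>\<close> for a singleton \<open>P\<close>. Adding one member \<open>e\<close> to a nonempty \<open>P\<close> raises \<open>d\<close> by less than
  \<open>\<gamma>\<close>: the edges coloured by \<open>e\<close> contribute at most \<open>\<gamma>\<close>, and nearly that much only if there is
  almost nothing else. So a gap \<open>(a, b)\<close> with \<open>b > \<gamma>\<close> and \<open>b - a \<ge> \<gamma>\<close> cannot be jumped over by adding
  members one by one, and \<open>d(P) \<le> a\<close> for all \<open>P\<close>. But \<open>d\<close> tends to \<open>1\<close> along the complete patterns.
\<close>

subsection \<open>Turan functions and the existence of the density\<close>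

text \<open>One injection replaces the intermediate subgraph and the isomorphism of
  \<open>free_of\<close>; it is easy to restrict and to compose with colourings.\<close>

definition embeds :: "'a hgraph \<Rightarrow> 'b hgraph \<Rightarrow> bool" where
  "embeds F G \<longleftrightarrow>
     (\<exists>f. inj_on f (verts F) \<and> f ` verts F \<subseteq> verts G \<and> (\<forall>e\<in>edges F. f ` e \<in> edges G))"

lemma r_graph_finite_edges: "r_graph r G \<Longrightarrow> finite (edges G)"
  by (rule finite_subset[of _ "Pow (verts G)"]) (auto simp: r_graph_def)

lemma r_graph_card_edges_le:
  assumes "r_graph r G"
  shows "card (edges G) \<le> card (verts G) choose r"
proof -
  have "card (edges G) \<le> card {B. B \<subseteq> verts G \<and> card B = r}"
    using assms by (intro card_mono) (auto simp: r_graph_def)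
  then show ?thesis
    using assms by (simp add: n_subsets r_graph_def)
qed

text \<open>The image of \<open>F\<close> under the injection serves as the subgraph; the
  \<open>r_graph\<close> hypothesis keeps its edges inside its vertex set.\<close>

lemma free_of_iff_embeds:
  assumes "\<forall>F\<in>\<F>. r_graph r F"
  shows "free_of \<F> G \<longleftrightarrow> \<not> (\<exists>F\<in>\<F>. embeds F G)"
proof -
  have "(\<exists>H. subgraph_of H G \<and> hgraph_iso F H) \<longleftrightarrow> embeds F G" if "F \<in> \<F>" for F
  proof
    assume "\<exists>H. subgraph_of H G \<and> hgraph_iso F H"
    then obtain H f where "subgraph_of H G" "bij_betw f (verts F) (verts H)"
      "edges H = (\<lambda>e. f ` e) ` edges F"
      by (auto simp: hgraph_iso_def)
    then show "embeds F G"
      unfolding embeds_def subgraph_of_def bij_betw_def by (intro exI[of _ f]) auto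
  next
    assume "embeds F G"
    then obtain f where f: "inj_on f (verts F)" "f ` verts F \<subseteq> verts G"
      "\<forall>e\<in>edges F. f ` e \<in> edges G"
      by (auto simp: embeds_def)
    have "\<forall>e\<in>edges F. e \<subseteq> verts F"
      using assms that by (auto simp: r_graph_def)
    then have "subgraph_of (f ` verts F, (\<lambda>e. f ` e) ` edges F) G"
      using f by (auto simp: subgraph_of_def)
    moreover have "hgraph_iso F (f ` verts F, (\<lambda>e. f ` e) ` edges F)"
      using f by (auto simp: hgraph_iso_def bij_betw_def)
    ultimately show "\<exists>H. subgraph_of H G \<and> hgraph_iso F H"
      by blast
  qed
  then show ?thesis
    by (auto simp: free_of_def)
qed

lemma turan_family_free_of:
  "turan_family r \<F> \<Longrightarrow> free_of \<F> G \<longleftrightarrow> \<not> (\<exists>F\<in>\<F>. embeds F G)"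
  by (rule free_of_iff_embeds) (auto simp: turan_family_def)

lemma finite_turan_ex_candidates:
  "finite {card (edges G) | G :: nat hgraph. r_graph r G \<and> card (verts G) = n \<and> free_of \<F> G}"
  by (rule finite_subset[of _ "{..n choose r}"]) (use r_graph_card_edges_le in fastforce, simp)

lemma card_edges_le_turan_ex:
  fixes G :: "nat hgraph"
  assumes "r_graph r G" "free_of \<F> G"
  shows "card (edges G) \<le> turan_ex r (card (verts G)) \<F>"
  unfolding turan_ex_def using assms by (intro Max_ge finite_turan_ex_candidates) blast

lemma turan_ex_attained:
  assumes "turan_family r \<F>"
  obtains G :: "nat hgraph" where "r_graph r G" "card (verts G) = n" "free_of \<F> G"
    "card (edges G) = turan_ex r n \<F>"
proof -
  let ?S = "{card (edges G) | G :: nat hgraph. r_graph r G \<and> card (verts G) = n \<and> free_of \<F> G}"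
  have "free_of \<F> ({..<n}, {} :: nat set set)"
    using assms unfolding turan_family_free_of[OF assms]
    by (auto simp: turan_family_def embeds_def)
  moreover have "r_graph r ({..<n}, {} :: nat set set)"
    by (simp add: r_graph_def)
  ultimately have "card (edges ({..<n}, {} :: nat set set)) \<in> ?S"
    by (intro CollectI exI[of _ "({..<n}, {} :: nat set set)"]) auto
  then have "Max ?S \<in> ?S"
    by (intro Max_in finite_turan_ex_candidates) auto
  then show ?thesis
    using that unfolding turan_ex_def by auto
qed

lemma turan_ex_mono:
  assumes "turan_family r \<G>" "\<F> \<subseteq> \<G>"
  shows "turan_ex r n \<G> \<le> turan_ex r n \<F>"
proof -
  obtain G :: "nat hgraph" where G: "r_graph r G" "card (verts G) = n" "free_of \<G> G"
    "card (edges G) = turan_ex r n \<G>"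
    using turan_ex_attained[OF assms(1)] .
  have "free_of \<F> G"
    using G(3) assms(2) by (auto simp: free_of_def)
  then show ?thesis
    using card_edges_le_turan_ex[OF G(1), of \<F>] G by simp
qed

text \<open>Double counting of pairs of a vertex and an edge avoiding it.\<close>

lemma turan_ex_Suc_le:
  assumes "turan_family r \<F>"
  shows "(Suc n - r) * turan_ex r (Suc n) \<F> \<le> Suc n * turan_ex r n \<F>"
proof -
  obtain G :: "nat hgraph" where G: "r_graph r G" "card (verts G) = Suc n" "free_of \<F> G"
    "card (edges G) = turan_ex r (Suc n) \<F>"
    using turan_ex_attained[OF assms] .
  have fin: "finite (verts G)" "finite (edges G)"
    using G(1) r_graph_finite_edges[OF G(1)] by (auto simp: r_graph_def)
  \<comment> \<open>Deleting \<open>v\<close> preserves freeness, and the surviving edges are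
    exactly those avoiding \<open>v\<close>.\<close>
  have del: "card {e \<in> edges G. v \<notin> e} \<le> turan_ex r n \<F>" if v: "v \<in> verts G" for v
  proof -
    let ?H = "(verts G - {v}, {e \<in> edges G. v \<notin> e})"
    have H: "r_graph r ?H"
      using G(1) by (auto simp: r_graph_def)
    have "embeds F G" if "embeds F ?H" for F :: "nat hgraph"
      using that unfolding embeds_def by fastforce
    then have "free_of \<F> ?H"
      using G(3) unfolding turan_family_free_of[OF assms] by blast
    from card_edges_le_turan_ex[OF H this] show ?thesis
      using v fin G(2) by simp
  qed
  have "(Suc n - r) * card (edges G) = (\<Sum>e\<in>edges G. card {v \<in> verts G. v \<notin> e})"
  proof -
    have "card {v \<in> verts G. v \<notin> e} = Suc n - r" if "e \<in> edges G" for e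
    proof -
      have "e \<subseteq> verts G" "card e = r"
        using G(1) that by (auto simp: r_graph_def)
      moreover have "{v \<in> verts G. v \<notin> e} = verts G - e"
        by auto
      ultimately show ?thesis
        using G(2) fin by (simp add: card_Diff_subset finite_subset)
    qed
    then show ?thesis
      by simp
  qed
  also have "\<dots> = (\<Sum>v\<in>verts G. card {e \<in> edges G. v \<notin> e})"
    using sum.swap_restrict[OF fin(2,1), of "\<lambda>_ _. 1::nat" "\<lambda>e v. v \<notin> e"] by simp
  also have "\<dots> \<le> (\<Sum>v\<in>verts G. turan_ex r n \<F>)"
    by (intro sum_mono del)
  finally show ?thesis
    using G by simp
qed

text \<open>The averaging bound makes the ratios nonincreasing from \<open>n = r\<close> on, and
  they are nonnegative. Since \<open>lim\<close> says nothing without convergence, every later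
  estimate of a density rests on this.\<close>

lemma turan_density_LIMSEQ:
  assumes "turan_family r \<F>"
  shows "(\<lambda>n. real (turan_ex r n \<F>) / real (n choose r)) \<longlonglongrightarrow> turan_density r \<F>"
proof -
  let ?X = "\<lambda>n. real (turan_ex r n \<F>) / real (n choose r)"
  have step: "?X (Suc n) \<le> ?X n" if "r \<le> n" for n
  proof -
    define d where "d = real (Suc n - r)"
    have d: "d > 0"
      using that by (simp add: d_def)
    have C: "d * real (Suc n choose r) = real (Suc n) * real (n choose r)"
      using binomial_absorb_comp[of "Suc n" r] unfolding d_def by (metis diff_Suc_1 of_nat_mult)
    have E: "d * real (turan_ex r (Suc n) \<F>) \<le> real (Suc n) * real (turan_ex r n \<F>)"
      using turan_ex_Suc_le[OF assms, of n] unfolding d_def of_nat_mult[symmetric] of_nat_le_iff .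
    have pos: "real (n choose r) > 0"
      using that by simp
    have "?X (Suc n) = (d * real (turan_ex r (Suc n) \<F>)) / (d * real (Suc n choose r))"
      using d by simp
    also have "\<dots> \<le> (real (Suc n) * real (turan_ex r n \<F>)) / (d * real (Suc n choose r))"
      using d by (intro divide_right_mono E) auto
    also have "\<dots> = ?X n"
      unfolding C by simp
    finally show ?thesis .
  qed
  \<comment> \<open>Below \<open>r\<close> the denominator is 0 and the quotient defaults to 0,
    hence the shift.\<close>
  have "decseq (\<lambda>n. ?X (n + r))"
    using step by (auto simp: decseq_Suc_iff)
  then obtain L where "(\<lambda>n. ?X (n + r)) \<longlonglongrightarrow> L"
    by (rule decseq_convergent[where B = 0]) auto
  then have "?X \<longlonglongrightarrow> L"
    by (rule LIMSEQ_offset)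
  then show ?thesis
    unfolding turan_density_def by (simp add: limI)
qed

text \<open>Here \<open>fact r * (n choose r)\<close> is a product of \<open>r\<close> factors
  \<open>n - i\<close>, each asymptotic to \<open>n\<close>. This converts edge counts measured
  against \<open>n ^ r\<close> into densities.\<close>

lemma power_over_binomial_LIMSEQ: "(\<lambda>n. real n ^ r / real (n choose r)) \<longlonglongrightarrow> fact r"
proof -
  have "(\<lambda>n. (\<Prod>i<r. 1 - real i / real n)) \<longlonglongrightarrow> (\<Prod>i<r. 1 - 0)"
    by (intro tendsto_prod tendsto_diff tendsto_const lim_const_over_n)
  then have "(\<lambda>n. fact r / (\<Prod>i<r. 1 - real i / real n)) \<longlonglongrightarrow> fact r / (\<Prod>i<r. 1 - 0)"
    by (intro tendsto_divide tendsto_const) auto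
  moreover have "eventually (\<lambda>n. fact r / (\<Prod>i<r. 1 - real i / real n) =
      real n ^ r / real (n choose r)) sequentially"
    using eventually_gt_at_top[of 0]
  proof eventually_elim
    case (elim n)
    have "(\<Prod>i<r. 1 - real i / real n) = (\<Prod>i<r. (real n - real i) / real n)"
      using elim by (intro prod.cong) (auto simp: field_simps)
    also have "\<dots> = fact r * real (n choose r) / real n ^ r"
      by (simp add: prod_dividef binomial_gbinomial gbinomial_mult_fact atLeast0LessThan)
    finally show ?case
      by simp
  qed
  ultimately show ?thesis
    by (simp add: filterlim_cong)
qed

subsection \<open>Colourings by a pattern\<close>

text \<open>The image of an edge must equal a member of \<open>P\<close>. If the members have
  \<open>r\<close> elements, every edge of an \<open>r\<close>-graph is thus rainbow, and for a
  singleton \<open>P\<close> this is \<open>r\<close>-partiteness.\<close>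

definition pattern_colorable :: "nat set set \<Rightarrow> 'a hgraph \<Rightarrow> bool" where
  "pattern_colorable P G \<longleftrightarrow> (\<exists>\<phi>. \<forall>e\<in>edges G. \<phi> ` e \<in> P)"

definition pattern_family :: "nat \<Rightarrow> nat set set \<Rightarrow> nat hgraph set" where
  "pattern_family r P = {F. r_graph r F \<and> \<not> pattern_colorable P F}"

text \<open>Colourings pull back along embeddings by composition.\<close>

lemma pattern_colorable_embeds:
  assumes "r_graph r F" "embeds F G" "pattern_colorable P G"
  shows "pattern_colorable P F"
proof -
  obtain f \<phi> where "\<forall>e\<in>edges F. f ` e \<in> edges G" "\<forall>e\<in>edges G. \<phi> ` e \<in> P"
    using assms by (auto simp: embeds_def pattern_colorable_def)
  then have "\<forall>e\<in>edges F. (\<phi> \<circ> f) ` e \<in> P"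
    by (metis image_comp)
  then show ?thesis
    unfolding pattern_colorable_def by blast
qed

lemma embeds_refl: "embeds G G"
  unfolding embeds_def by (rule exI[of _ id]) auto

lemma turan_family_pattern_family: "turan_family r (pattern_family r P)"
  by (auto simp: turan_family_def pattern_family_def pattern_colorable_def)

text \<open>A non-colourable \<open>G\<close> is itself forbidden and embeds in itself; a colourable
  one contains only colourable graphs.\<close>

lemma free_of_pattern_family_iff:
  fixes G :: "nat hgraph"
  assumes "r_graph r G"
  shows "free_of (pattern_family r P) G \<longleftrightarrow> pattern_colorable P G"
  unfolding turan_family_free_of[OF turan_family_pattern_family]
  using assms embeds_refl pattern_colorable_embeds unfolding pattern_family_def by blast

abbreviation pattern_density :: "nat \<Rightarrow> nat set set \<Rightarrow> real" where
  "pattern_density r P \<equiv> turan_density r (pattern_family r P)"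

lemmas pattern_density_LIMSEQ = turan_density_LIMSEQ[OF turan_family_pattern_family]

lemma pattern_density_in: "pattern_density r P \<in> turan_densities r"
  using turan_family_pattern_family by (auto simp: turan_densities_def)

text \<open>The balanced blow-up, with the \<open>k\<close> copies of \<open>i\<close> encoded as the pairs \<open>(i, j)\<close> with \<open>j < k\<close>.\<close>

lemma turan_ex_pattern_family_ge:
  assumes P: "\<And>E. E \<in> P \<Longrightarrow> E \<subseteq> S \<and> card E = r" and S: "finite S"
  shows "card P * k ^ r \<le> turan_ex r (k * card S) (pattern_family r P)"
proof -
  define V where "V = prod_encode ` (S \<times> {..<k})"
  \<comment> \<open>An edge of the blow-up is a member \<open>E\<close> of \<open>P\<close> together
    with a choice of one copy \<open>g i\<close> of each colour \<open>i\<close> in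
    \<open>E\<close>.\<close>
  define D where "D = Sigma P (\<lambda>E. PiE E (\<lambda>_. {..<k}))"
  define blow where "blow = (\<lambda>(E, g). (\<lambda>i. prod_encode (i, g i)) ` E)"
  define G where "G = (V, blow ` D)"
  have finP: "finite P"
    using P S by (intro finite_subset[of P "Pow S"]) auto
  have finE: "finite E" if "E \<in> P" for E
    using P[OF that] S finite_subset by blast
  have cardV: "card V = k * card S"
    unfolding V_def by (subst card_image) (auto simp: card_cartesian_product inj_on_def)
  \<comment> \<open>Forgetting the copies recovers \<open>E\<close>: this serves both the
    injectivity of \<open>blow\<close> and the colouring of the blow-up.\<close>
  have fst_blow: "(fst \<circ> prod_decode) ` blow (E, g) = E" for E g
    by (force simp: blow_def image_iff)
  have inj: "inj_on blow D"
  proof (rule inj_onI)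
    fix p q assume p: "p \<in> D" and q: "q \<in> D" and eq: "blow p = blow q"
    obtain E g E' g' where pq: "p = (E, g)" "q = (E', g')"
      by (cases p, cases q)
    have E: "E' = E"
      using eq fst_blow pq by metis
    have "g i = g' i" if "i \<in> E" for i
      using eq that by (auto simp: pq E blow_def image_iff set_eq_iff) (metis prod.inject prod_encode_inverse)
    moreover have "g \<in> PiE E (\<lambda>_. {..<k})" "g' \<in> PiE E (\<lambda>_. {..<k})"
      using p q by (auto simp: D_def pq E)
    ultimately have "g = g'"
      by (intro PiE_ext)
    then show "p = q"
      by (simp add: pq E)
  qed
  have "r_graph r G"
  proof -
    have "blow p \<subseteq> V \<and> card (blow p) = r" if "p \<in> D" for p
    proof -
      obtain E g where p: "p = (E, g)" "E \<in> P" "g \<in> PiE E (\<lambda>_. {..<k})"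
        using \<open>p \<in> D\<close> by (auto simp: D_def)
      have "inj_on (\<lambda>i. prod_encode (i, g i)) E"
        by (auto simp: inj_on_def)
      then show ?thesis
        using P[OF p(2)] p by (auto simp: blow_def V_def card_image)
    qed
    then show ?thesis
      using S by (auto simp: r_graph_def G_def V_def)
  qed
  moreover have "pattern_colorable P G"
    unfolding pattern_colorable_def
  proof (intro exI ballI)
    fix e assume "e \<in> edges G"
    then obtain E g where "e = blow (E, g)" "E \<in> P"
      by (auto simp: G_def D_def)
    then show "(fst \<circ> prod_decode) ` e \<in> P"
      using fst_blow by simp
  qed
  ultimately have "card (edges G) \<le> turan_ex r (card (verts G)) (pattern_family r P)"
    by (intro card_edges_le_turan_ex) (simp_all add: free_of_pattern_family_iff)
  moreover have "card (edges G) = card D"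
    using inj by (simp add: G_def card_image)
  moreover have "card D = (\<Sum>E\<in>P. k ^ r)"
    unfolding D_def using finP finE P
    by (subst card_SigmaI) (auto intro!: finite_PiE sum.cong simp: card_PiE)
  ultimately show ?thesis
    by (simp add: G_def cardV)
qed

text \<open>Balanced blow-ups have \<open>card P * k ^ r\<close> edges on \<open>k * card S\<close>
  vertices. As the density is known to exist, it may be estimated along these orders alone.\<close>

lemma pattern_density_ge:
  assumes P: "\<And>E. E \<in> P \<Longrightarrow> E \<subseteq> S \<and> card E = r" and S: "finite S" "S \<noteq> {}"
  shows "real (card P) / real (card S) ^ r * fact r \<le> pattern_density r P"
proof -
  define s where "s = card S"
  have s: "s > 0"
    using S by (simp add: s_def card_gt_0_iff)
  have sub: "strict_mono (\<lambda>k. k * s)"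
    using s by (simp add: strict_mono_def)
  have lim1: "(\<lambda>k. real (card P) / real s ^ r * (real (k * s) ^ r / real (k * s choose r)))
      \<longlonglongrightarrow> real (card P) / real s ^ r * fact r"
    using LIMSEQ_subseq_LIMSEQ[OF power_over_binomial_LIMSEQ sub]
    by (intro tendsto_mult tendsto_const) (simp add: o_def)
  have lim2: "(\<lambda>k. real (turan_ex r (k * s) (pattern_family r P)) / real (k * s choose r))
      \<longlonglongrightarrow> pattern_density r P"
    using LIMSEQ_subseq_LIMSEQ[OF pattern_density_LIMSEQ sub] by (simp add: o_def)
  have "real (card P) / real s ^ r * (real (k * s) ^ r / real (k * s choose r))
      \<le> real (turan_ex r (k * s) (pattern_family r P)) / real (k * s choose r)" for k
  proof -
    have "card P * k ^ r \<le> turan_ex r (k * s) (pattern_family r P)"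
      using turan_ex_pattern_family_ge[OF P S(1)] by (simp add: s_def)
    then have "real (card P) * real k ^ r \<le> real (turan_ex r (k * s) (pattern_family r P))"
      by (metis of_nat_le_iff of_nat_mult of_nat_power)
    then have "real (card P) * real k ^ r / real (k * s choose r)
      \<le> real (turan_ex r (k * s) (pattern_family r P)) / real (k * s choose r)"
      by (rule divide_right_mono) simp
    then show ?thesis
      using s by (simp add: power_mult_distrib)
  qed
  then show ?thesis
    using LIMSEQ_le[OF lim1 lim2] by (simp add: s_def)
qed

section \<open>Counting rainbow edges\<close>

text \<open>The inequality of arithmetic and geometric means, raised to the power
  \<open>card S\<close> to clear the root.\<close>

lemma prod_le_power_mean:
  fixes x :: "'a \<Rightarrow> real"
  assumes "finite S" "S \<noteq> {}" "\<And>i. i \<in> S \<Longrightarrow> x i \<ge> 0"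
  shows "(\<Prod>i\<in>S. x i) \<le> ((\<Sum>i\<in>S. x i) / card S) ^ card S"
proof -
  have c: "card S > 0"
    using assms by (simp add: card_gt_0_iff)
  have nonneg: "(\<Prod>i\<in>S. x i) \<ge> 0"
    using assms by (intro prod_nonneg) auto
  have "(\<Prod>i\<in>S. x i) = ((\<Prod>i\<in>S. x i) powr (1 / card S)) ^ card S"
  proof (cases "(\<Prod>i\<in>S. x i) = 0")
    case False
    then have "((\<Prod>i\<in>S. x i) powr (1 / card S)) ^ card S = (\<Prod>i\<in>S. x i) powr 1"
      using c nonneg by (subst powr_realpow[symmetric]) (simp_all add: powr_powr)
    then show ?thesis
      using nonneg by simp
  qed (use c in simp)
  also have "\<dots> \<le> (\<Sum>i\<in>S. x i / card S) ^ card S"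
    using assms by (intro power_mono arith_geom_mean) auto
  finally show ?thesis
    by (simp add: sum_divide_distrib)
qed

text \<open>A set counted on the left has exactly one vertex of each colour in \<open>E\<close>, so
  it is the range of a function choosing a vertex from each colour class.\<close>

lemma card_rainbow_sets_le:
  assumes "finite V" "finite E"
  shows "card {e. e \<subseteq> V \<and> card e = card E \<and> \<phi> ` e = E} \<le> (\<Prod>i\<in>E. card {v \<in> V. \<phi> v = i})"
proof -
  let ?C = "PiE E (\<lambda>i. {v \<in> V. \<phi> v = i})"
  have "{e. e \<subseteq> V \<and> card e = card E \<and> \<phi> ` e = E} \<subseteq> (\<lambda>g. g ` E) ` ?C"
  proof safe
    fix e assume e: "e \<subseteq> V" "card e = card (\<phi> ` e)"
    then have "inj_on \<phi> e"
      using assms(1) by (simp add: eq_card_imp_inj_on finite_subset)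
    then have "restrict (inv_into e \<phi>) (\<phi> ` e) ` \<phi> ` e = e"
      by simp
    moreover have "restrict (inv_into e \<phi>) (\<phi> ` e) \<in> PiE (\<phi> ` e) (\<lambda>i. {v \<in> V. \<phi> v = i})"
      using e(1) \<open>inj_on \<phi> e\<close> by auto
    ultimately show "e \<in> (\<lambda>g. g ` \<phi> ` e) ` PiE (\<phi> ` e) (\<lambda>i. {v \<in> V. \<phi> v = i})"
      by (intro image_eqI[OF sym])
  qed
  then have "card {e. e \<subseteq> V \<and> card e = card E \<and> \<phi> ` e = E} \<le> card ((\<lambda>g. g ` E) ` ?C)"
    using assms by (intro card_mono finite_imageI finite_PiE) auto
  also have "\<dots> \<le> card ?C"
    using assms by (intro card_image_le finite_PiE) auto
  finally show ?thesis
    using assms by (simp add: card_PiE)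
qed

text \<open>For a given sum the product of the class sizes is largest when they are equal, and their
  sum is the number of vertices coloured from \<open>E\<close>.\<close>

lemma card_rainbow_sets_le_power:
  assumes V: "finite V" and E: "finite E" "card E = r" "r > 0"
  shows "real (card {e. e \<subseteq> V \<and> card e = r \<and> \<phi> ` e = E})
       \<le> (real (card {v \<in> V. \<phi> v \<in> E}) / real r) ^ r"
proof -
  have "E \<noteq> {}"
    using E by auto
  have "card {e. e \<subseteq> V \<and> card e = r \<and> \<phi> ` e = E} \<le> (\<Prod>i\<in>E. card {v \<in> V. \<phi> v = i})"
    using card_rainbow_sets_le[OF V E(1), of \<phi>] E(2) by simp
  then have "real (card {e. e \<subseteq> V \<and> card e = r \<and> \<phi> ` e = E})
      \<le> (\<Prod>i\<in>E. real (card {v \<in> V. \<phi> v = i}))"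
    by (simp only: of_nat_prod[symmetric] of_nat_le_iff)
  also have "(\<Prod>i\<in>E. real (card {v \<in> V. \<phi> v = i}))
      \<le> ((\<Sum>i\<in>E. real (card {v \<in> V. \<phi> v = i})) / real r) ^ r"
    using prod_le_power_mean[OF E(1), of "\<lambda>i. real (card {v \<in> V. \<phi> v = i})"] E(2) \<open>E \<noteq> {}\<close>
    by (simp only: of_nat_0_le_iff not_False_eq_True simp_thms)
  also have "(\<Sum>i\<in>E. real (card {v \<in> V. \<phi> v = i})) = real (card {v \<in> V. \<phi> v \<in> E})"
  proof -
    have "{v \<in> V. \<phi> v \<in> E} = (\<Union>i\<in>E. {v \<in> V. \<phi> v = i})"
      by auto
    moreover have "card (\<Union>i\<in>E. {v \<in> V. \<phi> v = i}) = (\<Sum>i\<in>E. card {v \<in> V. \<phi> v = i})"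
      using V E by (intro card_UN_disjoint) auto
    ultimately show ?thesis
      by simp
  qed
  finally show ?thesis .
qed

lemma turan_density_mono:
  assumes "turan_family r \<G>" "\<F> \<subseteq> \<G>"
  shows "turan_density r \<G> \<le> turan_density r \<F>"
proof -
  have "turan_family r \<F>"
    using assms by (auto simp: turan_family_def)
  show ?thesis
    using turan_ex_mono[OF assms]
    by (intro LIMSEQ_le[OF turan_density_LIMSEQ[OF assms(1)] turan_density_LIMSEQ[OF \<open>turan_family r \<F>\<close>]])
      (auto intro!: divide_right_mono)
qed

text \<open>A larger pattern allows more colourings and so forbids fewer graphs.\<close>

lemma pattern_density_mono: "P \<subseteq> Q \<Longrightarrow> pattern_density r P \<le> pattern_density r Q"
  by (intro turan_density_mono turan_family_pattern_family)
    (unfold pattern_family_def pattern_colorable_def, blast)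

text \<open>From below, blow up the single edge \<open>E\<close>; from above, every edge is rainbow
  in the colours \<open>E\<close>, so the rainbow count bounds all of \<open>G\<close>.\<close>

lemma pattern_density_singleton:
  assumes "card E = r" "r > 0"
  shows "pattern_density r {E} = fact r / real r ^ r"
proof (rule antisym)
  have E: "finite E" "E \<noteq> {}"
    using assms card_ge_0_finite by auto
  then show "fact r / real r ^ r \<le> pattern_density r {E}"
    using pattern_density_ge[of "{E}" E r] assms by simp
  have "real (turan_ex r n (pattern_family r {E})) \<le> real n ^ r / real r ^ r" for n
  proof -
    obtain G :: "nat hgraph" where G: "r_graph r G" "card (verts G) = n"
        "free_of (pattern_family r {E}) G"
        "card (edges G) = turan_ex r n (pattern_family r {E})"
      using turan_ex_attained[OF turan_family_pattern_family] .
    obtain \<phi> where \<phi>: "\<forall>e\<in>edges G. \<phi> ` e = E"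
      using G(1,3) by (auto simp: free_of_pattern_family_iff pattern_colorable_def)
    have V: "finite (verts G)"
      using G(1) by (simp add: r_graph_def)
    have "card (edges G) \<le> card {e. e \<subseteq> verts G \<and> card e = r \<and> \<phi> ` e = E}"
      using G(1) \<phi> V by (intro card_mono) (auto simp: r_graph_def)
    also have "real \<dots> \<le> (real (card {v \<in> verts G. \<phi> v \<in> E}) / real r) ^ r"
      using card_rainbow_sets_le_power V E assms by blast
    also have "\<dots> \<le> (real n / real r) ^ r"
      using V G(2) card_mono[OF V, of "{v \<in> verts G. \<phi> v \<in> E}"]
      by (intro power_mono divide_right_mono) auto
    finally show ?thesis
      by (simp add: G(4) power_divide)
  qed
  then have "real (turan_ex r n (pattern_family r {E})) / real (n choose r)
      \<le> real n ^ r / real (n choose r) / real r ^ r" for n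
    by (metis divide_divide_eq_left divide_right_mono mult.commute of_nat_0_le_iff)
  then show "pattern_density r {E} \<le> fact r / real r ^ r"
    using assms
    by (intro LIMSEQ_le[OF pattern_density_LIMSEQ tendsto_divide[OF power_over_binomial_LIMSEQ tendsto_const]])
       auto
qed

section \<open>The cost of adding one member to a pattern\<close>

text \<open>Pick a vertex in \<open>U\<close> and then the other \<open>r - 1\<close> vertices;
  overcounting does no harm.\<close>

lemma card_sets_meeting_le:
  assumes "finite V" "U \<subseteq> V" "r > 0"
  shows "card {e. e \<subseteq> V \<and> card e = r \<and> e \<inter> U \<noteq> {}} \<le> card U * card V ^ (r - 1)"
proof -
  let ?F = "{f. f \<subseteq> V \<and> card f = r - 1}"
  have "finite ?F"
    using assms by (auto intro: finite_subset[of _ "Pow V"])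
  then have fin: "finite (U \<times> ?F)"
    using finite_subset[OF assms(2,1)] by (rule finite_cartesian_product[rotated])
  have "{e. e \<subseteq> V \<and> card e = r \<and> e \<inter> U \<noteq> {}} \<subseteq> (\<lambda>(v, f). insert v f) ` (U \<times> ?F)"
  proof
    fix e assume "e \<in> {e. e \<subseteq> V \<and> card e = r \<and> e \<inter> U \<noteq> {}}"
    then obtain v where e: "e \<subseteq> V" "card e = r" "v \<in> e" "v \<in> U"
      by blast
    then have "insert v (e - {v}) = e" "card (e - {v}) = r - 1"
      by auto
    then show "e \<in> (\<lambda>(v, f). insert v f) ` (U \<times> ?F)"
      using e by (intro image_eqI[of _ _ "(v, e - {v})"]) auto
  qed
  then have "card {e. e \<subseteq> V \<and> card e = r \<and> e \<inter> U \<noteq> {}} \<le> card (U \<times> ?F)"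
    using fin by (rule surj_card_le[rotated])
  also have "\<dots> = card U * (card V choose (r - 1))"
    using assms by (simp add: card_cartesian_product n_subsets)
  also have "\<dots> \<le> card U * card V ^ (r - 1)"
    by (intro mult_le_mono2 le_trans[OF _ binomial_fact_pow]) simp
  finally show ?thesis .
qed

text \<open>
  Almost \<open>n^r/r^r\<close> edges of the new colour class force almost all vertices to lie in that class, and
  then the old edges are negligible.
\<close>

lemma turan_ex_pattern_family_insert_le:
  assumes c: "card e = r" "\<And>E. E \<in> P \<Longrightarrow> card E = r" and r: "r > 0" and n: "n > 0"
    and R: "R = real r ^ r" and \<delta>: "\<delta> > 0"
  shows "real (turan_ex r n (pattern_family r (insert e P))) \<le>
     max (real (turan_ex r n (pattern_family r P)) + (1 / R - \<delta>) * real n ^ r)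
         ((1 / R + \<delta> * R) * real n ^ r)"
proof -
  obtain G :: "nat hgraph" where G: "r_graph r G" "card (verts G) = n"
      "free_of (pattern_family r (insert e P)) G"
      "card (edges G) = turan_ex r n (pattern_family r (insert e P))"
    using turan_ex_attained[OF turan_family_pattern_family] .
  obtain \<phi> where \<phi>: "\<forall>d\<in>edges G. \<phi> ` d \<in> insert e P"
    using G(1,3) by (auto simp: free_of_pattern_family_iff pattern_colorable_def)
  have V: "finite (verts G)"
    using G(1) by (simp add: r_graph_def)
  have fine: "finite e"
    using c(1) r card_ge_0_finite by auto
  have Rpos: "R > 0"
    using r R by simp
  \<comment> \<open>\<open>A\<close> holds the edges of the new colour set and \<open>B\<close> the
    rest, which \<open>P\<close> alone can colour; \<open>x\<close> is the fraction of vertices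
    coloured from \<open>e\<close>.\<close>
  define A where "A = {d \<in> edges G. \<phi> ` d = e}"
  define B where "B = {d \<in> edges G. \<phi> ` d \<noteq> e}"
  define x where "x = real (card {v \<in> verts G. \<phi> v \<in> e}) / real n"
  define U where "U = {v \<in> verts G. \<phi> v \<notin> e}"
  have "card (edges G) = card (A \<union> B)"
    by (rule arg_cong[of _ _ card]) (auto simp: A_def B_def)
  also have "\<dots> = card A + card B"
    using r_graph_finite_edges[OF G(1)] by (intro card_Un_disjoint) (auto simp: A_def B_def)
  finally have AB: "card (edges G) = card A + card B" .
  have "card {v \<in> verts G. \<phi> v \<in> e} \<le> n"
    using card_mono[OF V, of "{v \<in> verts G. \<phi> v \<in> e}"] G(2) by auto
  then have x: "0 \<le> x" "x \<le> 1"
    using n by (auto simp: x_def)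
  have U: "real (card U) = (1 - x) * real n"
  proof -
    have "card {v \<in> verts G. \<phi> v \<in> e} + card U = card ({v \<in> verts G. \<phi> v \<in> e} \<union> U)"
      using V by (intro card_Un_disjoint[symmetric]) (auto simp: U_def)
    also have "{v \<in> verts G. \<phi> v \<in> e} \<union> U = verts G"
      by (auto simp: U_def)
    finally have "real (card {v \<in> verts G. \<phi> v \<in> e}) + real (card U) = real n"
      using G(2) by (simp only: of_nat_add[symmetric])
    moreover have "x * real n = real (card {v \<in> verts G. \<phi> v \<in> e})"
      using n by (simp add: x_def)
    ultimately show ?thesis
      by (simp add: left_diff_distrib)
  qed
  have "card A \<le> card {d. d \<subseteq> verts G \<and> card d = r \<and> \<phi> ` d = e}"
    using G(1) V by (intro card_mono) (auto simp: r_graph_def A_def)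
  also have "real \<dots> \<le> (real (card {v \<in> verts G. \<phi> v \<in> e}) / real r) ^ r"
    using card_rainbow_sets_le_power V fine c(1) r by blast
  also have "\<dots> = x ^ r * real n ^ r / R"
    using n by (simp add: x_def R power_divide)
  finally have A: "real (card A) \<le> x ^ r * real n ^ r / R"
    by simp
  have B1: "card B \<le> turan_ex r n (pattern_family r P)"
  proof -
    have "r_graph r (verts G, B)"
      using G(1) by (auto simp: r_graph_def B_def)
    moreover have "pattern_colorable P (verts G, B)"
      using \<phi> by (auto simp: pattern_colorable_def B_def)
    ultimately show ?thesis
      using card_edges_le_turan_ex[of r "(verts G, B)" "pattern_family r P"] G(2)
      by (simp add: free_of_pattern_family_iff)
  qed
  \<comment> \<open>An edge of \<open>B\<close> has \<open>r\<close> different colours but not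
    exactly those of \<open>e\<close>, so one of its vertices has a colour outside
    \<open>e\<close>.\<close>
  have "B \<subseteq> {d. d \<subseteq> verts G \<and> card d = r \<and> d \<inter> U \<noteq> {}}"
  proof
    fix d assume "d \<in> B"
    then have d: "d \<in> edges G" "\<phi> ` d \<noteq> e" "d \<subseteq> verts G" "card d = r"
      using G(1) by (auto simp: B_def r_graph_def)
    then have "card (\<phi> ` d) = r"
      using \<phi> c by auto
    then have "\<not> \<phi> ` d \<subseteq> e"
      using d(2) c(1) fine card_subset_eq by metis
    then show "d \<in> {d. d \<subseteq> verts G \<and> card d = r \<and> d \<inter> U \<noteq> {}}"
      using d by (auto simp: U_def)
  qed
  then have "card B \<le> card {d. d \<subseteq> verts G \<and> card d = r \<and> d \<inter> U \<noteq> {}}"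
    using V by (intro card_mono) auto
  also have "\<dots> \<le> card U * n ^ (r - 1)"
    using card_sets_meeting_le[OF V _ r, of U] G(2) by (auto simp: U_def)
  finally have "real (card B) \<le> real (card U * n ^ (r - 1))"
    by (simp only: of_nat_le_iff)
  also have "\<dots> = (1 - x) * real n ^ r"
    using r by (cases r) (simp_all add: U)
  finally have B2: "real (card B) \<le> (1 - x) * real n ^ r" .
  show ?thesis
  \<comment> \<open>Few edges in \<open>A\<close> give the first term of the maximum. Otherwise
    \<open>x\<close> is near 1, few vertices lie in \<open>U\<close>, and the second term bounds
    everything.\<close>
  proof (cases "real (card A) \<le> (1 / R - \<delta>) * real n ^ r")
    case True
    then show ?thesis
      using B1 AB G(4) by linarith
  next
    case False
    \<comment> \<open>This avoids taking an \<open>r\<close>-th root of the lower bound on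
      \<open>x ^ r\<close>.\<close>
    have "x ^ r \<le> x"
      using x r power_decreasing[of 1 r x] by simp
    have "(1 / R - \<delta>) * real n ^ r < x ^ r / R * real n ^ r"
      using False A by simp
    then have "1 / R - \<delta> < x ^ r / R"
      by (rule mult_right_less_imp_less) simp
    then have "1 - \<delta> * R < x ^ r"
      using mult_strict_right_mono[OF _ Rpos, of "1 / R - \<delta>" "x ^ r / R"] Rpos
      by (simp add: left_diff_distrib)
    then have "1 - x \<le> \<delta> * R"
      using \<open>x ^ r \<le> x\<close> by linarith
    then have "real (card B) \<le> \<delta> * R * real n ^ r"
      using B2 by (meson mult_right_mono order_trans of_nat_0_le_iff zero_le_power)
    moreover have "real (card A) \<le> 1 / R * real n ^ r"
    proof -
      have "x ^ r \<le> 1"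
        using x by (simp add: power_le_one)
      then have "x ^ r * real n ^ r / R \<le> 1 * real n ^ r / R"
        using Rpos by (intro divide_right_mono mult_right_mono) auto
      then show ?thesis
        using A by simp
    qed
    ultimately show ?thesis
      using AB G(4) by (simp add: distrib_right)
  qed
qed

text \<open>In the limit, both terms of the preceding maximum stay below the target. Nonemptiness of
  \<open>P\<close> matters: from the empty pattern the increase is exactly
  \<open>r!/r^r\<close>.\<close>

lemma pattern_density_insert_less:
  assumes c: "card e = r" "\<And>E. E \<in> P \<Longrightarrow> card E = r" and r: "r > 0" and P: "P \<noteq> {}"
  shows "pattern_density r (insert e P) < pattern_density r P + fact r / real r ^ r"
proof -
  define R where "R = real r ^ r"
  \<comment> \<open>Chosen so that \<open>\<delta> * R = 1 / (2 * R)\<close>: the second term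
    becomes \<open>3/2 * fact r / R\<close>, whereas the target is at least
    \<open>2 * fact r / R\<close>.\<close>
  define \<delta> where "\<delta> = 1 / (2 * R\<^sup>2)"
  have R: "R > 0" and \<delta>: "\<delta> > 0"
    using r by (auto simp: R_def \<delta>_def)
  obtain E where E: "E \<in> P"
    using P by blast
  have d: "fact r / R \<le> pattern_density r P"
    using pattern_density_singleton[of E r] c(2)[OF E] r pattern_density_mono[of "{E}" P r] E
    by (simp add: R_def)
  let ?X = "\<lambda>n. real (turan_ex r n (pattern_family r P)) / real (n choose r)"
  let ?Y = "\<lambda>n. real n ^ r / real (n choose r)"
  have "(\<lambda>n. max (?X n + (1 / R - \<delta>) * ?Y n) ((1 / R + \<delta> * R) * ?Y n))
      \<longlonglongrightarrow> max (pattern_density r P + (1 / R - \<delta>) * fact r) ((1 / R + \<delta> * R) * fact r)"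
    by (intro tendsto_max tendsto_add tendsto_mult tendsto_const pattern_density_LIMSEQ
        power_over_binomial_LIMSEQ)
  moreover have "real (turan_ex r n (pattern_family r (insert e P))) / real (n choose r) \<le>
      max (?X n + (1 / R - \<delta>) * ?Y n) ((1 / R + \<delta> * R) * ?Y n)" if "n \<ge> 1" for n
  proof -
    have "real (turan_ex r n (pattern_family r (insert e P))) / real (n choose r) \<le>
     max (real (turan_ex r n (pattern_family r P)) + (1 / R - \<delta>) * real n ^ r)
         ((1 / R + \<delta> * R) * real n ^ r) / real (n choose r)"
      using turan_ex_pattern_family_insert_le[OF c r _ R_def \<delta>] that
      by (intro divide_right_mono) auto
    then show ?thesis
      by (simp add: max_divide_distrib_right add_divide_distrib)
  qed
  ultimately have "pattern_density r (insert e P) \<le>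
      max (pattern_density r P + (1 / R - \<delta>) * fact r) ((1 / R + \<delta> * R) * fact r)"
    by (intro LIMSEQ_le[OF pattern_density_LIMSEQ]) auto
  moreover have "(1 / R - \<delta>) * fact r < fact r / R"
    using \<delta> by (simp add: left_diff_distrib)
  moreover have "(1 / R + \<delta> * R) * fact r < pattern_density r P + fact r / R"
  proof -
    have "\<delta> * R * fact r = fact r / R / 2"
      using R by (simp add: \<delta>_def power2_eq_square)
    moreover have "fact r / R > 0"
      using R by simp
    ultimately show ?thesis
      using d by (simp add: distrib_right)
  qed
  ultimately show ?thesis
    by (simp add: R_def)
qed

section \<open>Excluding long gaps beyond \<open>r!/r^r\<close>\<close>

text \<open>Induction on \<open>P\<close>, from a singleton whose density lies below
  \<open>b\<close>. Each new member adds less than \<open>b - a\<close>, so a density that is at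
  most \<open>a\<close> stays below \<open>b\<close>, hence outside the gap and again at most
  \<open>a\<close>.\<close>

lemma pattern_density_le_gap:
  assumes gap: "is_gap r a b" and b: "fact r / real r ^ r < b" "a + fact r / real r ^ r \<le> b"
    and r: "r > 0" and P: "finite P" "P \<noteq> {}" "\<And>E. E \<in> P \<Longrightarrow> card E = r"
  shows "pattern_density r P \<le> a"
proof -
  have le: "pattern_density r Q \<le> a" if "pattern_density r Q < b" for Q
    using gap pattern_density_in[of r Q] that unfolding is_gap_def by force
  show ?thesis
    using P
  proof (induction P rule: finite_ne_induct)
    case (singleton E)
    then show ?case
      using le[of "{E}"] pattern_density_singleton[of E r] r b(1) by simp
  next
    case (insert e P)
    then have "pattern_density r (insert e P) < pattern_density r P + fact r / real r ^ r"
      using r by (intro pattern_density_insert_less) auto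
    moreover have "pattern_density r P \<le> a"
      using insert by auto
    ultimately show ?case
      using le b(2) by auto
  qed
qed

text \<open>Otherwise all complete patterns on \<open>m\<close> colours have density at most
  \<open>a\<close>. Their lower bounds \<open>fact r * (m choose r) / m ^ r\<close> tend to 1, so
  \<open>a \<ge> 1\<close>, which leaves no room inside the unit interval.\<close>

lemma gap_left_of_partite_density:
  assumes gap: "is_gap r a b" and len: "a + fact r / real r ^ r \<le> b" and r: "r > 0"
  shows "b \<le> fact r / real r ^ r"
proof (rule ccontr)
  assume "\<not> b \<le> fact r / real r ^ r"
  then have b: "fact r / real r ^ r < b"
    by simp
  have "fact r / (real m ^ r / real (m choose r)) \<le> a" if "m \<ge> r" for m
  proof -
    let ?P = "{E. E \<subseteq> {..<m} \<and> card E = r}"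
    have card: "card ?P = m choose r"
      using n_subsets[of "{..<m}"] by simp
    then have "?P \<noteq> {}"
      using that by (metis card.empty binomial_eq_0_iff not_le)
    moreover have "finite ?P"
      by (rule finite_subset[of _ "Pow {..<m}"]) auto
    ultimately have "pattern_density r ?P \<le> a"
      by (intro pattern_density_le_gap[OF gap b len r]) auto
    moreover have "real (card ?P) / real (card {..<m}) ^ r * fact r \<le> pattern_density r ?P"
      using that r by (intro pattern_density_ge) (auto simp: lessThan_empty_iff)
    ultimately show ?thesis
      using card by (simp add: mult.commute)
  qed
  moreover have "(\<lambda>m. fact r / (real m ^ r / real (m choose r))) \<longlonglongrightarrow> fact r / fact r"
    by (intro tendsto_divide tendsto_const power_over_binomial_LIMSEQ) auto
  ultimately have "fact r / fact r \<le> a"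
    using LIMSEQ_le_const2 by blast
  moreover have "(a + b) / 2 \<in> {a<..<b}"
    using gap by (auto simp: is_gap_def)
  then have "(a + b) / 2 < 1" "a < (a + b) / 2"
    using gap subsetD[of "{a<..<b}" "{0<..<1}" "(a + b) / 2"] by (auto simp: is_gap_def)
  ultimately show False
    by simp
qed

subsection \<open>Degenerate families\<close>

text \<open>Greedy choice with averaging, as in the Kovari-Sos-Turan theorem: each new element of
  \<open>T\<close> keeps at least a fraction \<open>\<delta>\<close> of the surviving
  \<open>w\<close>. The factor 2 in the degrees pays for neighbours already in
  \<open>T\<close>.\<close>

lemma exists_common_neighbours:
  fixes N :: "'b \<Rightarrow> 'a set"
  assumes fin: "finite W" "finite A" and N: "\<And>w. w \<in> W \<Longrightarrow> N w \<subseteq> A"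
    and deg: "\<And>w. w \<in> W \<Longrightarrow> 2 * \<delta> * real (card A) \<le> real (card (N w))"
    and \<delta>: "\<delta> > 0" "\<delta> \<le> 1"
  shows "real t \<le> \<delta> * real (card A) \<Longrightarrow>
    \<exists>T\<subseteq>A. card T = t \<and> \<delta> ^ t * real (card W) \<le> real (card {w \<in> W. T \<subseteq> N w})"
proof (induction t)
  case 0
  then show ?case
    by (intro exI[of _ "{}"]) auto
next
  case (Suc t)
  then obtain T where T: "T \<subseteq> A" "card T = t"
      "\<delta> ^ t * real (card W) \<le> real (card {w \<in> W. T \<subseteq> N w})"
    by auto
  define W' where "W' = {w \<in> W. T \<subseteq> N w}"
  have finT: "finite T" and fin': "finite W'" "finite (A - T)"
    using fin T finite_subset by (auto simp: W'_def)
  have "\<exists>a\<in>A - T. \<delta> * real (card W') \<le> real (card {w \<in> W'. a \<in> N w})"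
  proof (rule ccontr)
    assume "\<not> ?thesis"
    then have small: "real (card {w \<in> W'. a \<in> N w}) < \<delta> * real (card W')" if "a \<in> A - T" for a
      using that by (meson not_le)
    have "\<delta> * real (card A) \<le> 1 * real (card A)"
      using \<delta> by (intro mult_right_mono) auto
    then have "card T < card A"
      using Suc.prems T(2) by simp
    then obtain a where "a \<in> A - T"
      using T(1) by (metis Diff_eq_empty_iff all_not_in_conv linorder_not_less card_mono finT)
    then have "0 < \<delta> * real (card W')"
      using small by (metis of_nat_0_le_iff order_le_less_trans)
    then have k: "real (card W') > 0"
      using \<delta> by (simp add: zero_less_mult_iff)
    have "(\<Sum>a\<in>A - T. card {w \<in> W'. a \<in> N w}) = (\<Sum>w\<in>W'. card {a \<in> A - T. a \<in> N w})"
      using sum.swap_restrict[OF fin'(2,1), of "\<lambda>_ _. 1::nat" "\<lambda>a w. a \<in> N w"] by simp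
    then have eq: "(\<Sum>a\<in>A - T. real (card {w \<in> W'. a \<in> N w})) =
        (\<Sum>w\<in>W'. real (card {a \<in> A - T. a \<in> N w}))"
      by (metis (no_types, lifting) of_nat_sum sum.cong)
    \<comment> \<open>The surplus 1 per \<open>w\<close> yields the contradiction, since the same
      pairs counted by \<open>a\<close> number at most
      \<open>card A * \<delta> * card W'\<close>.\<close>
    have "(\<delta> * real (card A) + 1) * real (card W') = (\<Sum>w\<in>W'. \<delta> * real (card A) + 1)"
      by simp
    also have "\<dots> \<le> (\<Sum>w\<in>W'. real (card {a \<in> A - T. a \<in> N w}))"
    proof (intro sum_mono)
      fix w assume "w \<in> W'"
      then have w: "w \<in> W" "T \<subseteq> N w"
        by (auto simp: W'_def)
      have "{a \<in> A - T. a \<in> N w} = N w - T"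
        using N[OF w(1)] by auto
      moreover have "finite (N w)"
        using N[OF w(1)] fin finite_subset by auto
      ultimately have "real (card {a \<in> A - T. a \<in> N w}) = real (card (N w)) - real t"
        using w(2) finT T(2) card_mono[of "N w" T] by (simp add: card_Diff_subset of_nat_diff)
      then show "\<delta> * real (card A) + 1 \<le> real (card {a \<in> A - T. a \<in> N w})"
        using deg[OF w(1)] Suc.prems by simp
    qed
    also have "\<dots> = (\<Sum>a\<in>A - T. real (card {w \<in> W'. a \<in> N w}))"
      by (rule eq[symmetric])
    also have "\<dots> \<le> (\<Sum>a\<in>A - T. \<delta> * real (card W'))"
      using small by (intro sum_mono less_imp_le)
    also have "\<dots> = real (card (A - T)) * (\<delta> * real (card W'))"
      by simp
    also have "\<dots> \<le> real (card A) * (\<delta> * real (card W'))"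
      using \<delta> fin by (intro mult_right_mono) (auto intro: card_mono)
    finally show False
      using k by (simp add: algebra_simps)
  qed
  then obtain a where a: "a \<in> A" "a \<notin> T" "\<delta> * real (card W') \<le> real (card {w \<in> W'. a \<in> N w})"
    by auto
  have "{w \<in> W'. a \<in> N w} = {w \<in> W. insert a T \<subseteq> N w}"
    by (auto simp: W'_def)
  moreover have "\<delta> * (\<delta> ^ t * real (card W)) \<le> \<delta> * real (card W')"
    using T(3) \<delta> by (simp add: W'_def)
  ultimately have "\<delta> ^ Suc t * real (card W) \<le> real (card {w \<in> W. insert a T \<subseteq> N w})"
    using a(3) by simp
  then show ?case
    using a T finT by (intro exI[of _ "insert a T"]) auto
qed

text \<open>Erdos' theorem on complete \<open>r\<close>-partite subgraphs, for sets of
  \<open>r\<close>-tuples. Many tails have many possible heads; a common set \<open>T\<close> of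
  \<open>t\<close> heads serves a positive fraction of these tails, and the induction hypothesis
  applies to them. \<open>listset Ts\<close> is the product of the parts.\<close>

lemma dense_contains_listset:
  "\<epsilon> > 0 \<Longrightarrow> \<exists>n0. \<forall>(A :: 'a set) E. finite A \<longrightarrow> n0 \<le> card A \<longrightarrow>
     E \<subseteq> {xs. set xs \<subseteq> A \<and> length xs = r} \<longrightarrow> \<epsilon> * real (card A) ^ r \<le> real (card E) \<longrightarrow>
     (\<exists>Ts. length Ts = r \<and> (\<forall>T\<in>set Ts. T \<subseteq> A \<and> card T = t) \<and> listset Ts \<subseteq> E)"
proof (induction r arbitrary: \<epsilon>)
  case 0
  show ?case
  proof (intro exI[of _ 0] allI impI)
    fix A :: "'a set" and E :: "'a list set"
    assume "E \<subseteq> {xs. set xs \<subseteq> A \<and> length xs = 0}" "\<epsilon> * real (card A) ^ 0 \<le> real (card E)"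
    moreover from this have "E \<noteq> {}"
      using 0 by auto
    ultimately have "[] \<in> E"
      by auto
    then show "\<exists>Ts. length Ts = 0 \<and> (\<forall>T\<in>set Ts. T \<subseteq> A \<and> card T = t) \<and> listset Ts \<subseteq> E"
      by (intro exI[of _ "[]"]) simp
  qed
next
  case (Suc r)
  \<comment> \<open>Tails with fewer than \<open>2 * \<delta> * n\<close> heads account for at most
    half of the required tuples, as \<open>4 * \<delta> \<le> \<epsilon>\<close>; so at least
    \<open>2 * \<delta> * n ^ r\<close> other tails remain.\<close>
  define \<delta> where "\<delta> = min 1 (\<epsilon> / 4)"
  have \<delta>: "\<delta> > 0" "\<delta> \<le> 1" "4 * \<delta> \<le> \<epsilon>"
    using Suc.prems by (auto simp: \<delta>_def)
  have pos: "\<delta> ^ t * (2 * \<delta>) > 0"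
    using \<delta> by simp
  obtain n0 where n0: "\<And>(A :: 'a set) E. \<lbrakk>finite A; n0 \<le> card A;
     E \<subseteq> {xs. set xs \<subseteq> A \<and> length xs = r}; \<delta> ^ t * (2 * \<delta>) * real (card A) ^ r \<le> real (card E)\<rbrakk> \<Longrightarrow>
     \<exists>Ts. length Ts = r \<and> (\<forall>T\<in>set Ts. T \<subseteq> A \<and> card T = t) \<and> listset Ts \<subseteq> E"
    using Suc.IH[OF pos] by blast
  show ?case
  \<comment> \<open>The term with \<open>t / \<delta>\<close> ensures
    \<open>t \<le> \<delta> * n\<close>, which leaves room for \<open>T\<close>; the 1 makes
    \<open>A\<close> nonempty.\<close>
  proof (intro exI[of _ "max n0 (max 1 (nat \<lceil>real t / \<delta>\<rceil>))"] allI impI)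
    fix A :: "'a set" and E :: "'a list set"
    assume A: "finite A" "max n0 (max 1 (nat \<lceil>real t / \<delta>\<rceil>)) \<le> card A"
      and E: "E \<subseteq> {xs. set xs \<subseteq> A \<and> length xs = Suc r}"
        "\<epsilon> * real (card A) ^ Suc r \<le> real (card E)"
    define n where "n = real (card A)"
    have n: "n > 0" "real t \<le> \<delta> * n"
      using A(2) \<delta> by (auto simp: n_def field_simps)
    define N where "N = (\<lambda>w. {a \<in> A. a # w \<in> E})"
    define W0 where "W0 = {xs. set xs \<subseteq> A \<and> length xs = r}"
    define W where "W = {w \<in> W0. 2 * \<delta> * n \<le> real (card (N w))}"
    have "finite W0"
      using finite_lists_length_eq[OF A(1)] by (simp add: W0_def)
    then have fin: "finite W0" "finite W"
      by (simp_all add: W_def)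
    have W0: "real (card W0) = n ^ r"
      using card_lists_length_eq[OF A(1)] by (simp add: W0_def n_def)
    have "card E = (\<Sum>w\<in>W0. card (N w))"
    proof -
      have "bij_betw (\<lambda>(w, a). a # w) (Sigma W0 N) E"
      proof (rule bij_betw_imageI)
        show "inj_on (\<lambda>(w, a). a # w) (Sigma W0 N)"
          by (auto simp: inj_on_def)
        show "(\<lambda>(w, a). a # w) ` Sigma W0 N = E"
        proof
          show "E \<subseteq> (\<lambda>(w, a). a # w) ` Sigma W0 N"
          proof
            fix xs assume xs: "xs \<in> E"
            then obtain a w where "xs = a # w" "a \<in> A" "set w \<subseteq> A" "length w = r"
              using subsetD[OF E(1) xs] by (cases xs) auto
            then show "xs \<in> (\<lambda>(w, a). a # w) ` Sigma W0 N"
              using xs by (intro image_eqI[of _ _ "(w, a)"]) (auto simp: W0_def N_def)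
          qed
        qed (auto simp: N_def)
      qed
      then have "card E = card (Sigma W0 N)"
        by (simp add: bij_betw_same_card)
      also have "\<dots> = (\<Sum>w\<in>W0. card (N w))"
        using fin A(1) by (intro card_SigmaI) (auto simp: N_def)
      finally show ?thesis .
    qed
    then have "real (card E) = (\<Sum>w\<in>W0. real (card (N w)))"
      by simp
    also have "\<dots> \<le> (\<Sum>w\<in>W0. 2 * \<delta> * n + (if w \<in> W then n else 0))"
    proof (intro sum_mono)
      fix w assume "w \<in> W0"
      moreover have "real (card (N w)) \<le> n"
        using A(1) by (auto simp: n_def N_def intro: card_mono)
      moreover have "0 \<le> 2 * \<delta> * n"
        using \<delta> n by simp
      ultimately show "real (card (N w)) \<le> 2 * \<delta> * n + (if w \<in> W then n else 0)"
        by (auto simp: W_def)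
    qed
    also have "\<dots> = 2 * \<delta> * n * n ^ r + real (card W) * n"
    proof -
      have "W0 \<inter> W = W"
        by (auto simp: W_def)
      then show ?thesis
        using fin W0 by (simp add: sum.distrib sum.inter_restrict[symmetric])
    qed
    finally have "real (card E) \<le> 2 * \<delta> * n * n ^ r + real (card W) * n" .
    moreover have "4 * \<delta> * (n * n ^ r) \<le> \<epsilon> * (n * n ^ r)"
      using \<delta> n by (intro mult_right_mono) auto
    ultimately have "(2 * \<delta> * n ^ r) * n \<le> real (card W) * n"
      using E(2) by (simp add: n_def[symmetric] algebra_simps)
    then have W: "2 * \<delta> * n ^ r \<le> real (card W)"
      using n by simp
    obtain T where T: "T \<subseteq> A" "card T = t"
        "\<delta> ^ t * real (card W) \<le> real (card {w \<in> W. T \<subseteq> N w})"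
      using exists_common_neighbours[of W A N \<delta> t] fin A(1) \<delta> n
      by (auto simp: W_def N_def n_def)
    have "\<delta> ^ t * (2 * \<delta>) * n ^ r \<le> \<delta> ^ t * real (card W)"
      using W \<delta> by (simp add: mult.assoc)
    then have "\<delta> ^ t * (2 * \<delta>) * real (card A) ^ r \<le> real (card {w \<in> W. T \<subseteq> N w})"
      using T(3) by (simp add: n_def)
    moreover have "{w \<in> W. T \<subseteq> N w} \<subseteq> {xs. set xs \<subseteq> A \<and> length xs = r}"
      by (auto simp: W_def W0_def)
    ultimately obtain Ts where Ts: "length Ts = r" "\<forall>T\<in>set Ts. T \<subseteq> A \<and> card T = t"
        "listset Ts \<subseteq> {w \<in> W. T \<subseteq> N w}"
      using n0[of A] A by (metis (no_types, lifting) max.bounded_iff)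
    have "listset (T # Ts) \<subseteq> E"
      using Ts(3) by (auto simp: set_Cons_def N_def)
    then show "\<exists>Ts. length Ts = Suc r \<and> (\<forall>T\<in>set Ts. T \<subseteq> A \<and> card T = t) \<and> listset Ts \<subseteq> E"
      using Ts T by (intro exI[of _ "T # Ts"]) auto
  qed
qed

lemma in_listset_iff:
  "xs \<in> listset Ts \<longleftrightarrow> length xs = length Ts \<and> (\<forall>i<length Ts. xs ! i \<in> Ts ! i)"
proof (induction Ts arbitrary: xs)
  case (Cons T Ts)
  then show ?case
    by (cases xs) (auto simp: set_Cons_def All_less_Suc2)
qed simp

text \<open>
  The parts are nonempty and lists enumerating edges have distinct entries, so the parts are
  disjoint, and mapping each colour class into its own part is injective.
\<close>

lemma partite_embeds:
  fixes F :: "'b hgraph" and G :: "'a hgraph"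
  assumes F: "r_graph r F" "pattern_colorable {{..<r}} F" "edges F \<noteq> {}" and r: "r > 0"
    and Ts: "length Ts = r" "\<And>T. T \<in> set Ts \<Longrightarrow> T \<subseteq> verts G \<and> card T = card (verts F)"
    and sub: "listset Ts \<subseteq> {xs. set xs \<in> edges G \<and> distinct xs}"
  shows "embeds F G"
proof -
  obtain \<psi> where \<psi>: "\<forall>e\<in>edges F. \<psi> ` e = {..<r}"
    using F(2) by (auto simp: pattern_colorable_def)
  \<comment> \<open>Colours that are not below \<open>r\<close> occur only on vertices in no edge;
    they become 0, so that every vertex is assigned to a part.\<close>
  define \<phi> where "\<phi> v = (if \<psi> v < r then \<psi> v else 0)" for v
  have \<phi>: "\<phi> ` e = {..<r}" "inj_on \<phi> e" if "e \<in> edges F" for e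
  proof -
    have "\<psi> ` e = {..<r}"
      using \<psi> that by blast
    moreover have "\<phi> ` e = \<psi> ` e"
      using \<open>\<psi> ` e = {..<r}\<close> by (intro image_cong) (auto simp: \<phi>_def)
    ultimately show "\<phi> ` e = {..<r}"
      by simp
    moreover have "card e = r"
      using F(1) that by (auto simp: r_graph_def)
    moreover from this have "finite e"
      using r by (intro card_ge_0_finite) simp
    ultimately show "inj_on \<phi> e"
      by (intro eq_card_imp_inj_on) auto
  qed
  have \<phi>_less: "\<phi> v < r" for v
    using r by (simp add: \<phi>_def)
  have finV: "finite (verts F)"
    using F(1) by (simp add: r_graph_def)
  obtain e0 where "e0 \<in> edges F"
    using F(3) by blast
  then have "e0 \<subseteq> verts F" "e0 \<noteq> {}"
    using F(1) r by (auto simp: r_graph_def)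
  then have posV: "card (verts F) > 0"
    using finV by (auto simp: card_gt_0_iff)
  have T: "Ts ! i \<subseteq> verts G" "card (Ts ! i) = card (verts F)" if "i < r" for i
    using Ts that by auto
  have "\<exists>h. bij_betw h (verts F) (Ts ! i)" if "i < r" for i
  proof (rule finite_same_card_bij[OF finV])
    show "finite (Ts ! i)"
      using T[OF that] posV by (intro card_ge_0_finite) simp
  qed (use T[OF that] in simp)
  then obtain h where h: "\<And>i. i < r \<Longrightarrow> bij_betw (h i) (verts F) (Ts ! i)"
    by metis
  have disj: "i = j" if ij: "i < r" "j < r" and x: "x \<in> Ts ! i" "x \<in> Ts ! j" for i j x
  proof -
    \<comment> \<open>If parts \<open>i\<close> and \<open>j\<close> share \<open>x\<close>, this
      list lies in the product and has \<open>x\<close> in both positions; as its entries are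
      distinct, the positions agree.\<close>
    define ys where "ys = map (\<lambda>k. if k = i \<or> k = j then x else SOME y. y \<in> Ts ! k) [0..<r]"
    have "(SOME y. y \<in> Ts ! k) \<in> Ts ! k" if "k < r" for k
    proof -
      have "Ts ! k \<noteq> {}"
        using T(2)[OF that] posV by auto
      then show ?thesis
        by (simp add: some_in_eq)
    qed
    then have "ys \<in> listset Ts"
      using x Ts(1) by (auto simp: in_listset_iff ys_def)
    then have "distinct ys"
      using sub by auto
    moreover have "ys ! i = ys ! j" "i < length ys" "j < length ys"
      using ij by (auto simp: ys_def)
    ultimately show ?thesis
      by (simp add: nth_eq_iff_index_eq)
  qed
  define f where "f v = h (\<phi> v) v" for v
  have f_in: "f v \<in> Ts ! \<phi> v" if "v \<in> verts F" for v
    using h[OF \<phi>_less] that by (auto simp: f_def bij_betw_def)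
  have "inj_on f (verts F)"
  proof (rule inj_onI)
    fix v w assume vw: "v \<in> verts F" "w \<in> verts F" "f v = f w"
    then have "\<phi> v = \<phi> w"
      using disj[OF \<phi>_less \<phi>_less, of "f v" v w] f_in by metis
    then have "h (\<phi> v) v = h (\<phi> v) w"
      using vw(3) by (simp add: f_def)
    then show "v = w"
      using h[OF \<phi>_less] vw by (auto simp: bij_betw_def inj_on_def)
  qed
  moreover have "f ` verts F \<subseteq> verts G"
    using f_in T(1)[OF \<phi>_less] by blast
  moreover have "f ` e \<in> edges G" if e: "e \<in> edges F" for e
  proof -
    define g where "g = inv_into e \<phi>"
    have g: "g i \<in> e" "\<phi> (g i) = i" if "i < r" for i
      using \<phi>[OF e] that by (auto simp: g_def inv_into_into f_inv_into_f)
    have "e \<subseteq> verts F"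
      using F(1) e by (auto simp: r_graph_def)
    then have "map (\<lambda>i. f (g i)) [0..<r] \<in> listset Ts"
      using f_in g Ts(1) by (fastforce simp: in_listset_iff)
    moreover have "g ` {..<r} = e"
      using \<phi>[OF e] unfolding g_def by (metis inv_into_image_cancel order_refl)
    then have "set (map (\<lambda>i. f (g i)) [0..<r]) = f ` e"
      by (auto simp: image_image[symmetric] atLeast0LessThan)
    ultimately show ?thesis
      using sub by auto
  qed
  ultimately show ?thesis
    unfolding embeds_def by blast
qed

text \<open>For every \<open>\<epsilon> > 0\<close>, a large graph with more than
  \<open>\<epsilon> * n ^ r\<close> edges has a complete \<open>r\<close>-partite subgraph with
  parts of size \<open>card (verts F)\<close>, into which \<open>F\<close> embeds.\<close>

lemma turan_density_eq_0:
  assumes fam: "turan_family r \<F>" and F: "F \<in> \<F>" "pattern_colorable {{..<r}} F" and r: "r > 0"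
  shows "turan_density r \<F> = 0"
proof -
  have rF: "r_graph r F" "edges F \<noteq> {}"
    using fam F by (auto simp: turan_family_def)
  have bound: "\<forall>\<^sub>F n in sequentially. real (turan_ex r n \<F>) \<le> \<epsilon> * real n ^ r" if \<epsilon>: "\<epsilon> > 0" for \<epsilon>
  proof -
    obtain n0 where n0: "\<And>(A :: nat set) E. \<lbrakk>finite A; n0 \<le> card A;
       E \<subseteq> {xs. set xs \<subseteq> A \<and> length xs = r}; \<epsilon> * real (card A) ^ r \<le> real (card E)\<rbrakk> \<Longrightarrow>
       \<exists>Ts. length Ts = r \<and> (\<forall>T\<in>set Ts. T \<subseteq> A \<and> card T = card (verts F)) \<and> listset Ts \<subseteq> E"
      using dense_contains_listset[OF \<epsilon>, of r "card (verts F)", where 'a = nat] by blast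
    show ?thesis
      using eventually_ge_at_top[of n0]
    proof eventually_elim
      case (elim n)
      show ?case
      proof (rule ccontr)
        assume large: "\<not> ?thesis"
        obtain G :: "nat hgraph" where G: "r_graph r G" "card (verts G) = n" "free_of \<F> G"
            "card (edges G) = turan_ex r n \<F>"
          using turan_ex_attained[OF fam] .
        \<comment> \<open>All orderings of all edges; there are at least as many of them as edges,
          so they are dense among the tuples.\<close>
        define E where "E = {xs. set xs \<in> edges G \<and> distinct xs}"
        have V: "finite (verts G)"
          using G(1) by (simp add: r_graph_def)
        have sub: "E \<subseteq> {xs. set xs \<subseteq> verts G \<and> length xs = r}"
          using G(1) by (auto simp: E_def r_graph_def distinct_card[symmetric])
        have "edges G \<subseteq> set ` E"
        proof
          fix e assume e: "e \<in> edges G"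
          then have "finite e"
            using G(1) finite_subset[OF _ V] by (auto simp: r_graph_def)
          then obtain xs where "set xs = e" "distinct xs"
            using finite_distinct_list by blast
          then show "e \<in> set ` E"
            using e by (auto simp: E_def)
        qed
        moreover have "finite E"
          using sub V finite_lists_length_eq finite_subset by blast
        ultimately have "card (edges G) \<le> card E"
          using surj_card_le by blast
        then have "\<epsilon> * real (card (verts G)) ^ r \<le> real (card E)"
          using large G by simp
        then obtain Ts where Ts: "length Ts = r"
            "\<forall>T\<in>set Ts. T \<subseteq> verts G \<and> card T = card (verts F)" "listset Ts \<subseteq> E"
          using n0[OF V _ sub] elim G(2) by blast
        then have "embeds F G"
          using rF F r by (intro partite_embeds) (auto simp: E_def)
        then show False
          using G(3) F(1) turan_family_free_of[OF fam] by blast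
      qed
    qed
  qed
  have "turan_density r \<F> \<le> \<epsilon> * fact r" if "\<epsilon> > 0" for \<epsilon>
  proof (rule tendsto_le[OF sequentially_bot _ turan_density_LIMSEQ[OF fam]])
    show "(\<lambda>n. \<epsilon> * (real n ^ r / real (n choose r))) \<longlonglongrightarrow> \<epsilon> * fact r"
      by (intro tendsto_mult tendsto_const power_over_binomial_LIMSEQ)
    show "\<forall>\<^sub>F n in sequentially. real (turan_ex r n \<F>) / real (n choose r)
        \<le> \<epsilon> * (real n ^ r / real (n choose r))"
      using bound[OF that]
      by eventually_elim (simp add: divide_right_mono)
  qed
  from this[of "_ / fact r"] have "turan_density r \<F> \<le> 0 + \<epsilon>" if "\<epsilon> > 0" for \<epsilon>
    using that by simp
  then have "turan_density r \<F> \<le> 0"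
    by (rule field_le_epsilon)
  moreover have "0 \<le> turan_density r \<F>"
    by (rule LIMSEQ_le_const[OF turan_density_LIMSEQ[OF fam]]) auto
  ultimately show ?thesis
    by simp
qed

text \<open>No member is \<open>r\<close>-partite, so the family is part of the one for a singleton
  pattern, and forbidding less cannot lower the density.\<close>

lemma turan_density_ge_partite_density:
  assumes fam: "turan_family r \<F>" and F: "\<And>F. F \<in> \<F> \<Longrightarrow> \<not> pattern_colorable {{..<r}} F"
    and r: "r > 0"
  shows "fact r / real r ^ r \<le> turan_density r \<F>"
proof -
  have "\<F> \<subseteq> pattern_family r {{..<r}}"
    using fam F by (auto simp: turan_family_def pattern_family_def)
  then have "pattern_density r {{..<r}} \<le> turan_density r \<F>"
    by (intro turan_density_mono turan_family_pattern_family)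
  then show ?thesis
    using pattern_density_singleton[of "{..<r}" r] r by simp
qed

section \<open>The gap \<open>(0, r!/r^r)\<close> and its uniqueness\<close>

text \<open>A dichotomy: an \<open>r\<close>-partite member forces density 0, and without one the
  density is at least \<open>r!/r^r\<close>.\<close>

lemma is_gap_0_partite_density:
  assumes "r > 0"
  shows "is_gap r 0 (fact r / real r ^ r)"
proof -
  have "(fact r :: real) \<le> real r ^ r"
    by (metis fact_le_power order_refl of_nat_fact of_nat_le_iff of_nat_power)
  then have le: "fact r / real r ^ r \<le> 1"
    using assms by (simp add: divide_le_eq)
  have pos: "0 < fact r / real r ^ r"
    using assms by simp
  have "{0<..<fact r / real r ^ r} \<inter> turan_densities r = {}"
    using turan_density_eq_0 turan_density_ge_partite_density assms
    unfolding turan_densities_def by fastforce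
  moreover have "{0<..<fact r / real r ^ r} \<subseteq> {0<..<1}"
    using le by auto
  ultimately show ?thesis
    using pos by (simp add: is_gap_def)
qed

text \<open>The upper endpoint is at most \<open>r!/r^r\<close> and the lower one is at least 0, so
  the length pins both.\<close>

lemma long_gap_unique:
  assumes gap: "is_gap r a b" and len: "a + fact r / real r ^ r \<le> b" and r: "r > 0"
  shows "a = 0 \<and> b = fact r / real r ^ r"
proof -
  have "b \<le> fact r / real r ^ r"
    by (rule gap_left_of_partite_density[OF assms])
  moreover have "0 \<le> a"
  proof (rule ccontr)
    assume "\<not> 0 \<le> a"
    \<comment> \<open>For negative \<open>a\<close> both candidates exceed \<open>a\<close>; the
      minimum lies below \<open>b\<close> by the first and below 0 by the second.\<close>
    define c where "c = min ((a + b) / 2) (a / 2)"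
    have "c \<in> {a<..<b}" "c \<le> 0"
      using gap \<open>\<not> 0 \<le> a\<close> by (auto simp: is_gap_def min_def c_def)
    then show False
      using gap unfolding is_gap_def by force
  qed
  ultimately show ?thesis
    using len by simp
qed

theorem theorem1:
  fixes r :: nat
  assumes "r \<ge> 3"
  shows "max_gap r \<in> gap_lengths r \<and> (\<forall>g\<in>gap_lengths r. g \<le> max_gap r) \<and>
         max_gap r = fact r / real r ^ r \<and>
         (\<forall>a b. is_gap r a b \<and> b - a = fact r / real r ^ r
                  \<longleftrightarrow> a = 0 \<and> b = fact r / real r ^ r)"
proof -
  let ?\<gamma> = "fact r / real r ^ r"
  have r: "r > 0"
    using assms by simp
  have mem: "?\<gamma> \<in> gap_lengths r"
    using is_gap_0_partite_density[OF r] by (auto simp: gap_lengths_def intro!: exI[of _ 0])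
  have le: "g \<le> ?\<gamma>" if g: "g \<in> gap_lengths r" for g
  proof (rule ccontr)
    assume "\<not> g \<le> ?\<gamma>"
    moreover obtain a where "is_gap r a (a + g)"
      using g by (auto simp: gap_lengths_def)
    ultimately show False
      using long_gap_unique[of r a "a + g"] r by auto
  qed
  have max: "max_gap r = ?\<gamma>"
    unfolding max_gap_def using mem le by (rule Greatest_equality)
  have "is_gap r a b \<and> b - a = ?\<gamma> \<longleftrightarrow> a = 0 \<and> b = ?\<gamma>" for a b
    using long_gap_unique[of r a b] is_gap_0_partite_density[OF r] r by auto
  then show ?thesis
    using mem le max by simp
qed

end
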